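(* Let $\sigma\in\mathcal{M}^+(\mathbb{R}^n)$, $0<q<1$, and $0\le\alpha<n$. Then the following conditions are equivalent: (1) There exists a positive constant $\varkappa_w$ such that $\|M_\alpha\nu\|_{L^{q,\infty}(\sigma)}\le\varkappa_w\|\nu\|$ for all $\nu\in\mathcal{M}^+(\mathbb{R}^n)$. (2) There exists a constant $C>0$ such that $\sigma(E)\le C\,\big(H^{n-\alpha}(E)\big)^q$ for all Borel sets $E\subset\mathbb{R}^n$. (3) $M_\alpha\sigma\in L^{\frac q{1-q},\infty}(\sigma)$.
   Context: $\mathcal{M}^+(\mathbb{R}^n)$ is the class of nonnegative locally finite Borel measures on $\mathbb{R}^n$ and $\|\nu\|=\nu(\mathbb{R}^n)$. The fractional maximal operator is $M_\alpha\nu(x)=\sup_{Q\ni x}\frac{\nu(Q)}{|Q|^{1-\alpha/n}}$, the supremum being over all cubes $Q\subset\mathbb{R}^n$ containing $x$, where $|Q|$ is Lebesgue measure. For $0<r<\infty$, $\|f\|_{L^{r,\infty}(\sigma)}=\sup_{t>0}t\,\sigma(\{x:|f(x)|>t\})^{1/r}$, and $L^{r,\infty}(\sigma)$ consists of the $f$ for which this is finite. The Hausdorff content of $E\subset\mathbb{R}^n$ is $H^{n-\alpha}(E)=\inf\{\sum_{i=1}^\infty r_i^{n-\alpha}: E\subset\bigcup_{i=1}^\infty B(x_i,r_i)\}$, the infimum being over countable coverings of $E$ by balls. *)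

theory Defs
  imports "HOL-Analysis.Analysis"
begin

definition locally_finite_borel_measures :: "'a::topological_space measure set" where
  "locally_finite_borel_measures =
     {\<mu>. sets \<mu> = sets borel \<and> (\<forall>x. \<exists>U. open U \<and> x \<in> U \<and> emeasure \<mu> U < \<infinity>)}"

text \<open>Real powers on \<open>[0, \<infinity>]\<close>, used for exponents \<open>p > 0\<close> only: then
  \<open>0\<close> and \<open>\<infinity>\<close> are sent to themselves.\<close>

definition ennreal_powr :: "ennreal \<Rightarrow> real \<Rightarrow> ennreal" where
  "ennreal_powr x p = (if x = \<infinity> then \<infinity> else ennreal (enn2real x powr p))"

text \<open>Nondegenerate closed cubes with sides parallel to the axes. Using open cubes instead gives the
  same maximal functions, since every closed cube is contained in slightly larger open cubes.\<close>

definition cubes :: "(real ^ 'n) set set" where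
  "cubes = {cbox a (\<chi> i. a $ i + s) | a s. s > 0}"

definition fractional_maximal ::
    "real \<Rightarrow> (real ^ 'n) measure \<Rightarrow> real ^ 'n \<Rightarrow> ennreal" where
  "fractional_maximal \<alpha> \<nu> x =
     (SUP Q \<in> {Q \<in> cubes. x \<in> Q}.
        emeasure \<nu> Q / ennreal_powr (emeasure lborel Q) (1 - \<alpha> / real CARD('n)))"

definition weak_Lr_norm :: "real \<Rightarrow> 'a measure \<Rightarrow> ('a \<Rightarrow> ennreal) \<Rightarrow> ennreal" where
  "weak_Lr_norm r \<sigma> f =
     (SUP t \<in> {0::real<..}. ennreal t * ennreal_powr (emeasure \<sigma> {x \<in> space \<sigma>. f x > ennreal t}) (1 / r))"

text \<open>Measurability has to be part of membership: \<^const>\<open>emeasure\<close> is \<open>0\<close> on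
  non-measurable sets.\<close>

definition weak_Lr :: "real \<Rightarrow> 'a measure \<Rightarrow> ('a \<Rightarrow> ennreal) set" where
  "weak_Lr r \<sigma> = {f \<in> borel_measurable \<sigma>. weak_Lr_norm r \<sigma> f < \<infinity>}"

definition hausdorff_content :: "real \<Rightarrow> 'a::metric_space set \<Rightarrow> ennreal" where
  "hausdorff_content d E =
     (INF (x, r) \<in> {(x :: nat \<Rightarrow> 'a, r :: nat \<Rightarrow> real). (\<forall>i. r i > 0) \<and> E \<subseteq> (\<Union>i. ball (x i) (r i))}.
        \<Sum>i. ennreal (r i powr d))"

end

theory Submission
  imports Defs
begin

text \<open>
  Let \<open>d = n - \<alpha>\<close>. By the Vitali covering lemma, for finite \<open>\<nu>\<close> the content \<open>H\<^sup>d\<close> of a superlevel set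
  \<open>E = {M\<^sub>\<alpha> \<nu> > t}\<close> is at most \<open>c \<nu>(E) / t\<close>, since every cube witnessing \<open>M\<^sub>\<alpha> \<nu> > t\<close> at some point lies
  in \<open>E\<close>. With \<open>\<sigma>(E) \<le> C H\<^sup>d(E)\<^sup>q\<close> this yields the maximal inequality, and for \<open>\<nu> = \<sigma>\<close> (localised to
  balls) the factor \<open>\<sigma>(E)\<^sup>q\<close> on the right is absorbed because \<open>q < 1\<close>, which is the weak-type bound for
  \<open>M\<^sub>\<alpha> \<sigma>\<close>. Conversely, the maximal inequality is tested on sums of point masses at the centres of a
  cover. From the weak-type bound the content bound follows without any maximal function relative to
  \<open>\<sigma>\<close>: a ball of radius \<open>r\<close> carries at most \<open>(2r)\<^sup>d t\<close> of the mass of \<open>\<sigma>\<close> outside \<open>{M\<^sub>\<alpha> \<sigma> > t}\<close>.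
\<close>

section \<open>Powers and quotients in \<open>ennreal\<close>\<close>

lemma ennreal_powr_ennreal [simp]: "0 \<le> x \<Longrightarrow> ennreal_powr (ennreal x) p = ennreal (x powr p)"
  by (simp add: ennreal_powr_def)

lemma ennreal_powr_top [simp]: "ennreal_powr top p = top"
  by (simp add: ennreal_powr_def infinity_ennreal_def)

lemma ennreal_powr_mono:
  assumes "x \<le> y" "0 \<le> p"
  shows "ennreal_powr x p \<le> ennreal_powr y p"
proof (cases y)
  case (real b)
  then obtain a where "x = ennreal a" "0 \<le> a"
    using assms(1) by (cases x) (auto simp: top_unique)
  then show ?thesis
    using assms real by (auto intro!: ennreal_leI powr_mono2)
qed simp

lemma ennreal_less_divide_iff:
  assumes "0 < c" "0 \<le> t"
  shows "ennreal t < y / ennreal c \<longleftrightarrow> ennreal (t * c) < y"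
proof (cases y)
  case (real r)
  then show ?thesis
    using assms by (simp add: divide_ennreal ennreal_less_iff pos_less_divide_eq)
next
  case top
  then show ?thesis
    using assms by (simp add: ennreal_top_divide)
qed

section \<open>Cubes and superlevel sets of the fractional maximal function\<close>

abbreviation cube :: "real ^ 'n \<Rightarrow> real \<Rightarrow> (real ^ 'n) set" where
  "cube a s \<equiv> cbox a (\<chi> i. a $ i + s)"

lemma mem_cube: "x \<in> cube a s \<longleftrightarrow> (\<forall>i. a $ i \<le> x $ i \<and> x $ i \<le> a $ i + s)"
  by (simp add: mem_box_cart)

lemma emeasure_lborel_cube:
  fixes a :: "real ^ 'n"
  assumes "0 < s"
  shows "emeasure lborel (cube a s) = ennreal (s ^ CARD('n))"
proof -
  have "cube a s \<noteq> {}"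
    using assms mem_cube[of a a s] by auto
  then have "measure lborel (cube a s) = s ^ CARD('n)"
    by (simp add: content_cbox_cart)
  moreover have "emeasure lborel (cube a s) \<noteq> top"
    using emeasure_lborel_cbox_finite[of a] by (metis infinity_ennreal_def less_irrefl)
  ultimately show ?thesis
    by (subst emeasure_eq_ennreal_measure) auto
qed

text \<open>A cube of side \<open>s\<close> has volume \<open>s ^ n\<close>, so the denominator in
  the maximal function is \<open>s powr (n - \<alpha>)\<close>. Clearing it replaces the supremum of
  quotients by a single witnessing cube.\<close>

lemma less_fractional_maximal_iff:
  fixes \<nu> :: "(real ^ 'n) measure"
  assumes "0 \<le> t"
  shows "ennreal t < fractional_maximal \<alpha> \<nu> x \<longleftrightarrow>
    (\<exists>a s. 0 < s \<and> x \<in> cube a s \<and>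
       ennreal (t * s powr (real CARD('n) - \<alpha>)) < emeasure \<nu> (cube a s))"
proof -
  have *: "ennreal t < emeasure \<nu> (cube a s) /
        ennreal_powr (emeasure lborel (cube a s)) (1 - \<alpha> / real CARD('n))
      \<longleftrightarrow> ennreal (t * s powr (real CARD('n) - \<alpha>)) < emeasure \<nu> (cube a s)"
    if "0 < s" for a :: "real ^ 'n" and s
  proof -
    have "(s ^ CARD('n)) powr (1 - \<alpha> / real CARD('n)) = s powr (real CARD('n) - \<alpha>)"
      using that by (simp add: powr_realpow[symmetric] powr_powr right_diff_distrib)
    then show ?thesis
      using that assms by (simp add: emeasure_lborel_cube ennreal_less_divide_iff)
  qed
  have "ennreal t < fractional_maximal \<alpha> \<nu> x \<longleftrightarrow>
    (\<exists>a s. 0 < s \<and> x \<in> cube a s \<and> ennreal t < emeasure \<nu> (cube a s) /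
        ennreal_powr (emeasure lborel (cube a s)) (1 - \<alpha> / real CARD('n)))"
    unfolding fractional_maximal_def less_SUP_iff cubes_def by blast
  then show ?thesis
    using * by blast
qed

text \<open>A slight enlargement of a cube witnessing \<open>M\<^sub>\<alpha> \<nu> x > t\<close> still witnesses it, and
  contains \<open>x\<close> in its interior.\<close>

lemma open_superlevel_fractional_maximal:
  fixes \<nu> :: "(real ^ 'n) measure"
  assumes "0 \<le> t" "sets \<nu> = sets borel"
  shows "open {x. ennreal t < fractional_maximal \<alpha> \<nu> x}"
  unfolding open_subopen[of "Collect _"]
proof (intro ballI)
  let ?d = "real CARD('n) - \<alpha>"
  fix x assume "x \<in> {x. ennreal t < fractional_maximal \<alpha> \<nu> x}"
  then obtain a s where s: "0 < s" "x \<in> cube a s"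
    and less: "ennreal (t * s powr ?d) < emeasure \<nu> (cube a s)"
    by (auto simp: less_fractional_maximal_iff[OF assms(1)])
  have "((\<lambda>h. ennreal (t * (s + 2 * h) powr ?d)) \<longlongrightarrow> ennreal (t * (s + 2 * 0) powr ?d)) (at_right 0)"
    using s by (intro tendsto_intros) auto
  then have "\<forall>\<^sub>F h in at_right 0. ennreal (t * (s + 2 * h) powr ?d) < emeasure \<nu> (cube a s)"
    using less by (intro order_tendstoD(2)) auto
  then have "\<forall>\<^sub>F h in at_right 0. ennreal (t * (s + 2 * h) powr ?d) < emeasure \<nu> (cube a s) \<and> 0 < h"
    by (intro eventually_conj eventually_at_right_less)
  then obtain h where h: "ennreal (t * (s + 2 * h) powr ?d) < emeasure \<nu> (cube a s)" "0 < h"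
    using eventually_happens'[OF trivial_limit_at_right_real] by blast
  \<comment> \<open>The cube grows by \<open>h\<close> on every side, hence the corner shift
    \<open>h\<close> and the side \<open>s + 2 * h\<close>.\<close>
  define b where "b = (\<chi> i. a $ i - h)"
  define U where "U = box b (\<chi> i. b $ i + (s + 2 * h))"
  have "cube a s \<subseteq> cube b (s + 2 * h)"
  proof
    fix y assume y: "y \<in> cube a s"
    have "a $ i - h \<le> y $ i \<and> y $ i \<le> a $ i - h + (s + 2 * h)" for i
      using y[unfolded mem_cube, rule_format, of i] h(2) by linarith
    then show "y \<in> cube b (s + 2 * h)"
      by (simp add: mem_box_cart b_def)
  qed
  then have "emeasure \<nu> (cube a s) \<le> emeasure \<nu> (cube b (s + 2 * h))"
    by (intro emeasure_mono) (auto simp: assms)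
  then have big: "ennreal (t * (s + 2 * h) powr ?d) < emeasure \<nu> (cube b (s + 2 * h))"
    using h by order
  have "a $ i - h < x $ i \<and> x $ i < a $ i - h + (s + 2 * h)" for i
    using s(2)[unfolded mem_cube, rule_format, of i] h(2) by linarith
  then have "x \<in> U"
    by (simp add: U_def b_def mem_box_cart)
  moreover have "U \<subseteq> {x. ennreal t < fractional_maximal \<alpha> \<nu> x}"
  proof
    fix y assume "y \<in> U"
    then have "y \<in> cube b (s + 2 * h)"
      using box_subset_cbox unfolding U_def by blast
    then show "y \<in> {x. ennreal t < fractional_maximal \<alpha> \<nu> x}"
      using big s h by (auto simp: less_fractional_maximal_iff[OF assms(1)] intro!: exI[of _ b] exI[of _ "s + 2 * h"])
  qed
  ultimately show "\<exists>T. open T \<and> x \<in> T \<and> T \<subseteq> {x. ennreal t < fractional_maximal \<alpha> \<nu> x}"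
    unfolding U_def by (blast intro: open_box)
qed

lemma borel_measurable_fractional_maximal:
  fixes \<nu> :: "(real ^ 'n) measure"
  assumes "sets \<nu> = sets borel"
  shows "fractional_maximal \<alpha> \<nu> \<in> borel_measurable borel"
proof (rule borel_measurableI_greater)
  fix y :: ennreal
  show "{x \<in> space borel. y < fractional_maximal \<alpha> \<nu> x} \<in> sets borel"
    by (cases y) (auto intro!: borel_open open_superlevel_fractional_maximal assms)
qed

lemma fractional_maximal_le:
  fixes \<nu> :: "(real ^ 'n) measure"
  assumes "x \<in> cube a s" "0 < s" "0 \<le> t" "fractional_maximal \<alpha> \<nu> x \<le> ennreal t"
  shows "emeasure \<nu> (cube a s) \<le> ennreal (t * s powr (real CARD('n) - \<alpha>))"
  using assms less_fractional_maximal_iff[of t \<alpha> \<nu> x] by (metis not_le)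

lemma fractional_maximal_mono:
  fixes \<mu> \<nu> :: "(real ^ 'n) measure"
  assumes "\<And>a s. emeasure \<mu> (cube a s) \<le> emeasure \<nu> (cube a s)"
  shows "fractional_maximal \<alpha> \<mu> x \<le> fractional_maximal \<alpha> \<nu> x"
  unfolding fractional_maximal_def using assms
  by (intro SUP_mono) (auto simp: cubes_def intro!: divide_right_mono_ennreal)

section \<open>Estimates for the Hausdorff content and the weak norm\<close>

lemma hausdorff_content_le:
  assumes "\<And>i. 0 < r i" "E \<subseteq> (\<Union>i. ball (x i) (r i))"
  shows "hausdorff_content d E \<le> (\<Sum>i. ennreal (r i powr d))"
  unfolding hausdorff_content_def using assms by (intro INF_lower2[of "(x, r)"]) auto

text \<open>Balls of tiny radius pad a cover indexed by a subset of \<open>\<nat>\<close> to a full sequence.\<close>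

lemma hausdorff_content_le_subset:
  fixes E :: "'a::metric_space set"
  assumes "0 < d" "\<And>j. j \<in> J \<Longrightarrow> 0 < r j" "E \<subseteq> (\<Union>j\<in>J. ball (x j) (r j))"
  shows "hausdorff_content d E \<le> (\<Sum>j. if j \<in> J then ennreal (r j powr d) else 0)"
proof (rule ennreal_le_epsilon)
  fix e :: real assume e: "0 < e"
  \<comment> \<open>The padding radii are chosen so that their \<open>d\<close>-th powers are
    \<open>e / 2 ^ (j + 1)\<close>, which sum to \<open>e\<close>.\<close>
  define \<rho> where "\<rho> j = (if j \<in> J then r j else (e * (1 / 2) ^ Suc j) powr (1 / d))" for j
  have "E \<subseteq> (\<Union>j. ball (x j) (\<rho> j))"
    using assms(3) by (force simp: \<rho>_def)
  then have "hausdorff_content d E \<le> (\<Sum>j. ennreal (\<rho> j powr d))"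
    using assms(2) e by (intro hausdorff_content_le[where x = x]) (auto simp: \<rho>_def)
  also have "\<dots> \<le> (\<Sum>j. (if j \<in> J then ennreal (r j powr d) else 0) + ennreal (e * (1 / 2) ^ Suc j))"
    using assms(1) e by (intro suminf_le) (auto simp: \<rho>_def powr_powr)
  also have "\<dots> = (\<Sum>j. if j \<in> J then ennreal (r j powr d) else 0) + (\<Sum>j. ennreal (e * (1 / 2) ^ Suc j))"
    by (simp add: suminf_add)
  also have "(\<Sum>j. ennreal (e * (1 / 2) ^ Suc j)) = ennreal e"
  proof (rule suminf_ennreal_eq)
    show "(\<lambda>j. e * (1 / 2) ^ Suc j) sums e"
      using sums_mult[OF power_half_series, of e] by simp
  qed (use e in auto)
  finally show "hausdorff_content d E \<le> (\<Sum>j. if j \<in> J then ennreal (r j powr d) else 0) + ennreal e" .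
qed

text \<open>Raising to the power \<open>q\<close> is an increasing bijection of the extended
  half-line with inverse exponent \<open>1 / q\<close>. Isolating \<open>y\<close> matters when
  \<open>y\<close> is a content: a lower bound for an infimum can be checked cover by cover.\<close>

lemma le_mult_ennreal_powr_iff:
  assumes "0 < c" "0 < q"
  shows "v \<le> ennreal c * ennreal_powr y q \<longleftrightarrow> ennreal_powr (v / ennreal c) (1 / q) \<le> y"
proof (cases "v = top \<or> y = top")
  case True
  then show ?thesis
    using assms by (auto simp: ennreal_mult_top ennreal_top_divide top_unique ennreal_powr_def
        ennreal_mult_eq_top_iff)
next
  case False
  then obtain a b where ab: "v = ennreal a" "0 \<le> a" "y = ennreal b" "0 \<le> b"
    by (cases v; cases y) auto
  have "a \<le> c * b powr q \<longleftrightarrow> a / c \<le> b powr q"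
    using assms by (simp add: field_simps)
  also have "\<dots> \<longleftrightarrow> (a / c) powr (1 / q) \<le> (b powr q) powr (1 / q)"
    using assms ab by (metis divide_nonneg_pos not_le powr_ge_zero powr_less_mono2 powr_mono2
        less_imp_le zero_less_divide_1_iff)
  also have "(b powr q) powr (1 / q) = b"
    using assms ab by (simp add: powr_powr)
  finally show ?thesis
    using assms ab by (simp add: divide_ennreal ennreal_mult[symmetric])
qed

text \<open>Solving each term of the supremum for the measure of the superlevel set turns a norm
  bound into a bound on the distribution function, with a real right-hand side.\<close>

lemma weak_Lr_norm_le_iff:
  assumes "0 < r" "0 \<le> w"
  shows "weak_Lr_norm r \<sigma> f \<le> ennreal w \<longleftrightarrow>
    (\<forall>t>0. emeasure \<sigma> {x \<in> space \<sigma>. ennreal t < f x} \<le> ennreal ((w / t) powr r))"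
proof -
  have "ennreal t * ennreal_powr v (1 / r) \<le> ennreal w \<longleftrightarrow> v \<le> ennreal ((w / t) powr r)"
    if "0 < t" for t v
  proof (cases v)
    case (real a)
    have "t * a powr (1 / r) \<le> w \<longleftrightarrow> a powr (1 / r) \<le> w / t"
      using that by (simp add: field_simps)
    also have "\<dots> \<longleftrightarrow> (a powr (1 / r)) powr r \<le> (w / t) powr r"
      using assms that real by (metis divide_nonneg_pos not_le powr_ge_zero powr_less_mono2 powr_mono2
          less_imp_le)
    also have "(a powr (1 / r)) powr r = a"
      using assms real by (simp add: powr_powr)
    finally show ?thesis
      using that real assms by (simp add: ennreal_mult[symmetric])
  next
    case top
    then show ?thesis
      using that by (simp add: ennreal_mult_top top_unique)
  qed
  then show ?thesis
    unfolding weak_Lr_norm_def SUP_le_iff by auto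
qed

lemma term_le_suminf_ennreal: "f k \<le> (\<Sum>i. f i)" for f :: "nat \<Rightarrow> ennreal"
  using sum_le_suminf[of f "{k}"] by simp

text \<open>Only covers with finite positive sum \<open>S\<close> need checking: a cover with
  infinite sum gives a trivial bound, and a sum of zero is impossible since
  \<open>r 0 > 0\<close>.\<close>

lemma le_hausdorff_contentI:
  fixes E :: "'a::metric_space set"
  assumes "0 < c" "0 < q"
    and cover: "\<And>(x :: nat \<Rightarrow> 'a) r S. (\<And>i. 0 < r i) \<Longrightarrow> E \<subseteq> (\<Union>i. ball (x i) (r i)) \<Longrightarrow>
      0 < S \<Longrightarrow> (\<Sum>i. ennreal (r i powr d)) = ennreal S \<Longrightarrow> v \<le> ennreal (c * S powr q)"
  shows "v \<le> ennreal c * ennreal_powr (hausdorff_content d E) q"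
  unfolding le_mult_ennreal_powr_iff[OF assms(1,2)] hausdorff_content_def
proof (rule INF_greatest, clarify)
  fix x :: "nat \<Rightarrow> 'a" and r :: "nat \<Rightarrow> real"
  assume r: "\<forall>i. 0 < r i" and E: "E \<subseteq> (\<Union>i. ball (x i) (r i))"
  show "ennreal_powr (v / ennreal c) (1 / q) \<le> (\<Sum>i. ennreal (r i powr d))"
  proof (cases "(\<Sum>i. ennreal (r i powr d))")
    case (real S)
    have "0 < ennreal (r 0 powr d)"
      using r[rule_format, of 0] by simp
    also have "\<dots> \<le> (\<Sum>i. ennreal (r i powr d))"
      by (rule term_le_suminf_ennreal)
    finally have "0 < S"
      unfolding real(2) by simp
    then have "v \<le> ennreal (c * S powr q)"
      using r E real(2) by (intro cover[of r x]) auto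
    then show ?thesis
      unfolding le_mult_ennreal_powr_iff[OF assms(1,2), symmetric]
      using real assms by (simp add: ennreal_mult)
  qed simp
qed

section \<open>Covering argument for superlevel sets\<close>

text \<open>The norm is at most the sum of the \<open>n\<close> coordinate differences, each at most
  \<open>s\<close>. This gives the radius of the balls to which the Vitali lemma is applied.\<close>

lemma cube_subset_cball:
  fixes x :: "real ^ 'n"
  assumes "x \<in> cube a s"
  shows "cube a s \<subseteq> cball x (real CARD('n) * s)"
proof
  fix y assume y: "y \<in> cube a s"
  have "\<bar>(x - y) $ i\<bar> \<le> s" for i
    using assms[unfolded mem_cube, rule_format, of i] y[unfolded mem_cube, rule_format, of i]
    by (simp add: abs_le_iff)
  then have "norm (x - y) \<le> (\<Sum>i\<in>(UNIV :: 'n set). s)"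
    by (intro order.trans[OF norm_le_l1_cart] sum_mono)
  then show "y \<in> cball x (real CARD('n) * s)"
    by (simp add: dist_norm)
qed

lemma ball_subset_cube: "ball x r \<subseteq> cube (\<chi> i. x $ i - r) (2 * r)"
proof
  fix y assume "y \<in> ball x r"
  then have "\<bar>x $ i - y $ i\<bar> < r" for i
    using component_le_norm_cart[of "x - y" i] by (simp add: dist_norm)
  then have "x $ i - r \<le> y $ i \<and> y $ i \<le> x $ i - r + 2 * r" for i
    by (smt (verit))
  then show "y \<in> cube (\<chi> i. x $ i - r) (2 * r)"
    by (simp add: mem_box_cart)
qed

text \<open>The cubes selected by the Vitali lemma are disjoint and lie inside the superlevel set, so
  the right-hand side is the mass of the superlevel set itself and not only the total mass.\<close>

lemma hausdorff_content_superlevel_le: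
  fixes \<nu> :: "(real ^ 'n) measure"
  assumes sets: "sets \<nu> = sets borel" and fin: "emeasure \<nu> UNIV < \<infinity>"
    and "0 < t" "\<alpha> < real CARD('n)"
  defines "d \<equiv> real CARD('n) - \<alpha>" and "E \<equiv> {x. ennreal t < fractional_maximal \<alpha> \<nu> x}"
  shows "hausdorff_content d E \<le> ennreal ((5 * real CARD('n)) powr d / t) * emeasure \<nu> E"
proof -
  let ?n = "real CARD('n)"
  have d: "0 < d"
    using assms by (simp add: d_def)
  have n: "0 < ?n"
    by simp
  have "\<forall>x\<in>E. \<exists>a s. 0 < s \<and> x \<in> cube a s \<and> ennreal (t * s powr d) < emeasure \<nu> (cube a s)"
    using \<open>0 < t\<close> by (auto simp: E_def d_def less_fractional_maximal_iff)
  then obtain a s where s: "\<And>x. x \<in> E \<Longrightarrow> 0 < s x" "\<And>x. x \<in> E \<Longrightarrow> x \<in> cube (a x) (s x)"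
    and big: "\<And>x. x \<in> E \<Longrightarrow> ennreal (t * s x powr d) < emeasure \<nu> (cube (a x) (s x))"
    by metis
  \<comment> \<open>The cube that witnesses the level \<open>t\<close> at \<open>x\<close> witnesses
    it at each of its own points.\<close>
  have sub: "cube (a x) (s x) \<subseteq> E" if "x \<in> E" for x
    using s(1)[OF that] big[OF that] \<open>0 < t\<close>
    by (auto simp: E_def less_fractional_maximal_iff d_def)
  obtain M where M: "emeasure \<nu> UNIV = ennreal M" "0 \<le> M"
    using fin by (cases "emeasure \<nu> UNIV") auto
  \<comment> \<open>The Vitali lemma requires bounded radii; the finite total mass \<open>M\<close>
    supplies the bound, since \<open>t * s x powr d < M\<close>.\<close>
  have radius: "0 < ?n * s x \<and> ?n * s x \<le> ?n * (M / t) powr (1 / d)" if x: "x \<in> E" for x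
  proof -
    have "emeasure \<nu> (cube (a x) (s x)) \<le> ennreal M"
      unfolding M(1)[symmetric] by (intro emeasure_mono) (auto simp: sets)
    then have "ennreal (t * s x powr d) < ennreal M"
      using big[OF x] by order
    then have "s x powr d \<le> M / t"
      using \<open>0 < t\<close> M(2) by (simp add: ennreal_less_iff field_simps)
    then have "(s x powr d) powr (1 / d) \<le> (M / t) powr (1 / d)"
      using d by (intro powr_mono2) auto
    then show ?thesis
      using s(1)[OF x] d by (simp add: powr_powr)
  qed
  \<comment> \<open>The ball of radius \<open>?n * s x\<close> about \<open>x\<close> contains the
    cube chosen at \<open>x\<close>, so disjointness of the selected balls passes to their
    cubes.\<close>
  have "\<exists>C. countable C \<and> C \<subseteq> E \<and>
      pairwise (\<lambda>x y. disjnt (cball x (?n * s x)) (cball y (?n * s y))) C \<and>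
      (\<forall>x\<in>E. \<exists>y\<in>C. cball x (?n * s x) \<subseteq> ball y (5 * (?n * s y)))"
    by (rule Vitali_covering_lemma_cballs_balls[where K = E and r = "\<lambda>x. ?n * s x" and a = "\<lambda>x. x",
          OF radius]) (assumption, intro exI conjI, assumption+, blast)
  then obtain C where C: "countable C" "C \<subseteq> E"
      "pairwise (\<lambda>x y. disjnt (cball x (?n * s x)) (cball y (?n * s y))) C"
      "\<forall>x\<in>E. \<exists>y\<in>C. cball x (?n * s x) \<subseteq> ball y (5 * (?n * s y))"
    by (elim exE conjE)
  \<comment> \<open>The countable set \<open>C\<close> is enumerated by \<open>J\<close>, a set of
    naturals that may be finite; indices outside \<open>J\<close> get the empty set in
    \<open>A\<close>.\<close>
  define J where "J = to_nat_on C ` C"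
  define g where "g = from_nat_into C"
  have g: "g j \<in> C" if "j \<in> J" for j
    using that C(1) by (auto simp: J_def g_def)
  have inj: "j = k" if "j \<in> J" "k \<in> J" "g j = g k" for j k
    using that C(1) by (auto simp: J_def g_def)
  define A where "A j = (if j \<in> J then cube (a (g j)) (s (g j)) else {})" for j
  have "disjoint_family A"
  proof (unfold disjoint_family_on_def, intro ballI impI)
    fix j k :: nat assume "j \<noteq> k"
    show "A j \<inter> A k = {}"
    proof (cases "j \<in> J \<and> k \<in> J")
      case True
      then have "g j \<noteq> g k" and gE: "g j \<in> E" "g k \<in> E"
        using inj g C(2) \<open>j \<noteq> k\<close> by auto
      then have "disjnt (cball (g j) (?n * s (g j))) (cball (g k) (?n * s (g k)))"
        using C(3) g True by (auto simp: pairwise_def)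
      then show ?thesis
        using cube_subset_cball[OF s(2)[OF gE(1)]] cube_subset_cball[OF s(2)[OF gE(2)]]
        by (auto simp: A_def disjnt_def)
    qed (auto simp: A_def)
  qed
  have "E \<subseteq> (\<Union>j\<in>J. ball (g j) (5 * (?n * s (g j))))"
  proof
    fix x assume x: "x \<in> E"
    then obtain y where y: "y \<in> C" "cball x (?n * s x) \<subseteq> ball y (5 * (?n * s y))"
      using C(4) by blast
    have "x \<in> cball x (?n * s x)"
      using s(1)[OF x] by simp
    then have "x \<in> ball y (5 * (?n * s y))"
      using y(2) by blast
    moreover have "g (to_nat_on C y) = y" "to_nat_on C y \<in> J"
      using y C(1) by (auto simp: g_def J_def)
    ultimately show "x \<in> (\<Union>j\<in>J. ball (g j) (5 * (?n * s (g j))))"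
      by (intro UN_I[of "to_nat_on C y"]) simp_all
  qed
  then have "hausdorff_content d E \<le>
      (\<Sum>j. if j \<in> J then ennreal ((5 * (?n * s (g j))) powr d) else 0)"
    using radius g C(2) d
    by (intro hausdorff_content_le_subset) (auto intro!: mult_pos_pos s(1))
  also have "\<dots> \<le> (\<Sum>j. ennreal ((5 * ?n) powr d / t) * emeasure \<nu> (A j))"
  proof (intro suminf_le summableI)
    fix j
    show "(if j \<in> J then ennreal ((5 * (?n * s (g j))) powr d) else 0)
        \<le> ennreal ((5 * ?n) powr d / t) * emeasure \<nu> (A j)"
    proof (cases "j \<in> J")
      case True
      then have gE: "g j \<in> E"
        using g C(2) by auto
      have "(5 * (?n * s (g j))) powr d = (5 * ?n) powr d / t * (t * s (g j) powr d)"
        using s(1)[OF gE] \<open>0 < t\<close> by (simp add: powr_mult)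
      also have "ennreal \<dots> = ennreal ((5 * ?n) powr d / t) * ennreal (t * s (g j) powr d)"
        using \<open>0 < t\<close> by (intro ennreal_mult) auto
      also have "\<dots> \<le> ennreal ((5 * ?n) powr d / t) * emeasure \<nu> (cube (a (g j)) (s (g j)))"
        using big[OF gE] by (intro mult_left_mono) auto
      finally show ?thesis
        using True by (simp add: A_def)
    qed simp
  qed
  also have "\<dots> = ennreal ((5 * ?n) powr d / t) * emeasure \<nu> (\<Union>j. A j)"
    using \<open>disjoint_family A\<close>
    by (subst ennreal_suminf_cmult, subst suminf_emeasure) (auto simp: sets A_def)
  also have "\<dots> \<le> ennreal ((5 * ?n) powr d / t) * emeasure \<nu> E"
  proof (intro mult_left_mono emeasure_mono)
    show "(\<Union>j. A j) \<subseteq> E"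
      using sub g C(2) by (auto simp: A_def split: if_splits)
    show "E \<in> sets \<nu>"
      using open_superlevel_fractional_maximal[of t \<nu> \<alpha>] sets \<open>0 < t\<close> by (auto simp: E_def)
  qed auto
  finally show ?thesis .
qed

text \<open>The content estimate is inserted into the hypothesis on \<sigma>. The right-hand side
  keeps the \<nu>-mass of the superlevel set: bounding it by the total mass gives the maximal
  inequality, while absorbing it gives the weak-type bound.\<close>

lemma emeasure_superlevel_le:
  fixes \<sigma> \<nu> :: "(real ^ 'n) measure"
  assumes "0 < c" "0 < q" "\<alpha> < real CARD('n)"
    and content: "\<forall>E\<in>sets borel.
      emeasure \<sigma> E \<le> ennreal c * ennreal_powr (hausdorff_content (real CARD('n) - \<alpha>) E) q"
    and sets: "sets \<nu> = sets borel" and fin: "emeasure \<nu> UNIV < \<infinity>" and "0 < t"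
  defines "w \<equiv> c powr (1 / q) * (5 * real CARD('n)) powr (real CARD('n) - \<alpha>)"
  shows "emeasure \<sigma> {x. ennreal t < fractional_maximal \<alpha> \<nu> x}
    \<le> ennreal ((w / t * measure \<nu> {x. ennreal t < fractional_maximal \<alpha> \<nu> x}) powr q)"
proof -
  define K where "K = (5 * real CARD('n)) powr (real CARD('n) - \<alpha>)"
  have "0 < K"
    by (simp add: K_def)
  let ?E = "{x. ennreal t < fractional_maximal \<alpha> \<nu> x}"
  define m where "m = measure \<nu> ?E"
  have "0 \<le> m"
    by (simp add: m_def)
  have "emeasure \<nu> ?E \<le> emeasure \<nu> UNIV"
    by (intro emeasure_mono) (auto simp: sets)
  then have m: "emeasure \<nu> ?E = ennreal m"
    using fin unfolding m_def by (intro emeasure_eq_ennreal_measure) (auto simp: top_unique)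
  have "hausdorff_content (real CARD('n) - \<alpha>) ?E \<le> ennreal (K / t) * ennreal m"
    using hausdorff_content_superlevel_le[OF sets fin \<open>0 < t\<close> assms(3)] unfolding m K_def .
  then have H: "hausdorff_content (real CARD('n) - \<alpha>) ?E \<le> ennreal (K / t * m)"
    using \<open>0 < t\<close> \<open>0 \<le> m\<close> \<open>0 < K\<close> by (subst ennreal_mult) auto
  have "?E \<in> sets borel"
    using \<open>0 < t\<close> by (intro borel_open open_superlevel_fractional_maximal sets) auto
  then have "emeasure \<sigma> ?E
      \<le> ennreal c * ennreal_powr (hausdorff_content (real CARD('n) - \<alpha>) ?E) q"
    by (rule content[rule_format])
  also have "\<dots> \<le> ennreal c * ennreal_powr (ennreal (K / t * m)) q"
    using \<open>0 < q\<close> by (intro mult_left_mono ennreal_powr_mono H) auto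
  also have "\<dots> = ennreal (c * (K / t * m) powr q)"
    using \<open>0 < c\<close> \<open>0 < t\<close> \<open>0 \<le> m\<close> \<open>0 < K\<close> by (subst ennreal_powr_ennreal) (auto simp: ennreal_mult)
  \<comment> \<open>Writing \<open>c\<close> as a \<open>q\<close>-th power moves it inside, which
    explains the factor \<open>c powr (1 / q)\<close> in \<open>w\<close>.\<close>
  also have "c * (K / t * m) powr q = (c powr (1 / q)) powr q * (K / t * m) powr q"
    using \<open>0 < c\<close> \<open>0 < q\<close> by (simp only: powr_powr) simp
  also have "\<dots> = (c powr (1 / q) * (K / t * m)) powr q"
    by (rule powr_mult[symmetric])
  also have "c powr (1 / q) * (K / t * m) = c powr (1 / q) * K / t * m"
    by simp
  finally show "emeasure \<sigma> ?E \<le> ennreal ((w / t * measure \<nu> ?E) powr q)"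
    unfolding m_def w_def K_def .
qed

section \<open>The implications between the three conditions\<close>

lemma emeasure_compact_finite:
  assumes "\<sigma> \<in> locally_finite_borel_measures" "compact K"
  shows "emeasure \<sigma> K < \<infinity>"
proof -
  have sets: "sets \<sigma> = sets borel"
    using assms by (simp add: locally_finite_borel_measures_def)
  have "\<forall>x. \<exists>U. open U \<and> x \<in> U \<and> emeasure \<sigma> U < \<infinity>"
    using assms(1) unfolding locally_finite_borel_measures_def by blast
  then obtain U where U: "\<And>x. open (U x) \<and> x \<in> U x \<and> emeasure \<sigma> (U x) < \<infinity>"
    by metis
  have "open (U x)" if "x \<in> K" for x
    using U by blast
  moreover have "K \<subseteq> (\<Union>x\<in>K. U x)"
    using U by blast
  ultimately have "\<exists>F\<subseteq>K. finite F \<and> K \<subseteq> (\<Union>x\<in>F. U x)"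
    by (rule compactE_image[OF assms(2)]) blast+
  then obtain F where F: "F \<subseteq> K" "finite F" "K \<subseteq> (\<Union>x\<in>F. U x)"
    by blast
  have "emeasure \<sigma> K \<le> emeasure \<sigma> (\<Union>x\<in>F. U x)"
    using F U by (intro emeasure_mono) (auto simp: sets)
  also have "\<dots> \<le> (\<Sum>x\<in>F. emeasure \<sigma> (U x))"
    using F U by (intro emeasure_subadditive_finite) (auto simp: sets)
  also have "\<dots> < \<infinity>"
    using F U by simp
  finally show ?thesis .
qed

text \<open>For \<open>m > 0\<close>, dividing by \<open>m powr q\<close> leaves
  \<open>m powr (1 - q)\<close>, and \<open>1 - q > 0\<close> allows taking the root. This division
  is why \<open>m\<close> has to be finite when the lemma is applied.\<close>

lemma powr_absorb:
  fixes m z q :: real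
  assumes "0 \<le> m" "0 < z" "q < 1" "m \<le> (z * m) powr q"
  shows "m \<le> z powr (q / (1 - q))"
proof (cases "m = 0")
  case False
  then have "m powr (1 - q) * m powr q \<le> z powr q * m powr q"
    using assms by (simp add: powr_add[symmetric] powr_mult)
  then have "m powr (1 - q) \<le> z powr q"
    using False assms by simp
  then have "(m powr (1 - q)) powr (1 / (1 - q)) \<le> (z powr q) powr (1 / (1 - q))"
    using assms by (intro powr_mono2) auto
  then show ?thesis
    using assms by (simp add: powr_powr)
qed simp

text \<open>Testing the maximal inequality on \<open>\<Sum>i. r i powr d\<close> times the Dirac mass at \<open>x i\<close>, for a cover
  of \<open>E\<close> by the balls \<open>ball (x i) (r i)\<close>.\<close>

lemma content_bound_if_maximal_bound:
  fixes \<sigma> :: "(real ^ 'n) measure"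
  assumes sets: "sets \<sigma> = sets borel" and "0 < q" "0 < k"
    and bound: "\<And>\<nu>. \<nu> \<in> locally_finite_borel_measures \<Longrightarrow>
      weak_Lr_norm q \<sigma> (fractional_maximal \<alpha> \<nu>) \<le> ennreal k * emeasure \<nu> UNIV"
  defines "d \<equiv> real CARD('n) - \<alpha>"
  shows "emeasure \<sigma> E \<le> ennreal ((k * 2 powr (d + 1)) powr q) * ennreal_powr (hausdorff_content d E) q"
proof (rule le_hausdorff_contentI)
  fix x :: "nat \<Rightarrow> real ^ 'n" and r :: "nat \<Rightarrow> real" and S :: real
  assume r: "\<And>i. 0 < r i" and E: "E \<subseteq> (\<Union>i. ball (x i) (r i))"
    and "0 < S" and S: "(\<Sum>i. ennreal (r i powr d)) = ennreal S"
  \<comment> \<open>As an image of a weighted counting measure, \<nu> adds the weights of coinciding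
    centres.\<close>
  define \<nu> where "\<nu> = distr (density (count_space UNIV) (\<lambda>i. ennreal (r i powr d))) borel x"
  \<comment> \<open>The cube of side \<open>2 * r i\<close> about \<open>x i\<close> has mass at
    least \<open>r i powr d\<close>, which is twice \<open>t * (2 * r i) powr d\<close>; the spare
    factor 2 makes the inequality strict.\<close>
  define t where "t = 1 / 2 powr (d + 1)"
  have t: "0 < t"
    by (simp add: t_def)
  have \<nu>: "emeasure \<nu> A = (\<Sum>i. ennreal (r i powr d) * indicator A (x i))" if "A \<in> sets borel" for A
    using that unfolding \<nu>_def
    by (simp add: emeasure_distr emeasure_density nn_integral_count_space_nat indicator_vimage)
  have total: "emeasure \<nu> UNIV = ennreal S"
    by (simp add: \<nu> S)
  have sets_\<nu>: "sets \<nu> = sets borel"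
    by (simp add: \<nu>_def)
  have "\<nu> \<in> locally_finite_borel_measures"
    unfolding locally_finite_borel_measures_def using total sets_\<nu> by (auto intro!: exI[of _ UNIV])
  from bound[OF this] have "weak_Lr_norm q \<sigma> (fractional_maximal \<alpha> \<nu>) \<le> ennreal (k * S)"
    using \<open>0 < k\<close> \<open>0 < S\<close> by (simp add: total ennreal_mult)
  then have weak: "emeasure \<sigma> {x \<in> space \<sigma>. ennreal t < fractional_maximal \<alpha> \<nu> x}
      \<le> ennreal ((k * S / t) powr q)"
    using assms \<open>0 < S\<close> t by (subst (asm) weak_Lr_norm_le_iff) auto
  have "E \<subseteq> {x. ennreal t < fractional_maximal \<alpha> \<nu> x}"
  proof
    fix y assume "y \<in> E"
    then obtain i where i: "y \<in> ball (x i) (r i)"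
      using E by blast
    define Q where "Q = cube (\<chi> j. x i $ j - r i) (2 * r i)"
    have "x i \<in> Q" "y \<in> Q"
      using ball_subset_cube[of "x i" "r i"] i r[of i] centre_in_ball unfolding Q_def by blast+
    have "t * (2 * r i) powr d = r i powr d / 2"
      using r[of i] by (simp add: t_def powr_mult powr_add)
    moreover have "0 < r i powr d"
      using r[of i] by simp
    ultimately have "t * (2 * r i) powr d < r i powr d"
      by linarith
    then have "ennreal (t * (2 * r i) powr d) < ennreal (r i powr d)"
      using t by (intro ennreal_lessI) auto
    also have "\<dots> \<le> (\<Sum>j. ennreal (r j powr d) * indicator Q (x j))"
      using term_le_suminf_ennreal[of "\<lambda>j. ennreal (r j powr d) * indicator Q (x j)" i]
        \<open>x i \<in> Q\<close> by simp
    also have "\<dots> = emeasure \<nu> Q"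
      by (simp add: \<nu> Q_def)
    finally have "ennreal (t * (2 * r i) powr d) < emeasure \<nu> Q" .
    then have "ennreal t < fractional_maximal \<alpha> \<nu> y"
      using \<open>y \<in> Q\<close> r[of i] t unfolding Q_def d_def
      by (subst less_fractional_maximal_iff)
        (auto simp del: vec_lambda_beta intro!: exI[of _ "\<chi> j. x i $ j - r i"] exI[of _ "2 * r i"])
    then show "y \<in> {x. ennreal t < fractional_maximal \<alpha> \<nu> x}"
      by simp
  qed
  then have "emeasure \<sigma> E \<le> emeasure \<sigma> {x \<in> space \<sigma>. ennreal t < fractional_maximal \<alpha> \<nu> x}"
    using open_superlevel_fractional_maximal[of t \<nu> \<alpha>] sets_\<nu> t sets_eq_imp_space_eq[OF sets]
    by (intro emeasure_mono) (auto simp: sets)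
  also have "\<dots> \<le> ennreal ((k * S / t) powr q)"
    by (rule weak)
  also have "(k * S / t) powr q = (k * 2 powr (d + 1)) powr q * S powr q"
    using assms \<open>0 < S\<close> by (subst powr_mult[symmetric]) (auto simp: t_def mult_ac)
  finally show "emeasure \<sigma> E \<le> ennreal ((k * 2 powr (d + 1)) powr q * S powr q)" .
qed (use assms in auto)

text \<open>For finite \<nu> the mass of a superlevel set is at most the total mass. For infinite
  \<nu> the right-hand side is \<open>top\<close>, because \<open>w > 0\<close>.\<close>

lemma maximal_bound_if_content_bound:
  fixes \<sigma> \<nu> :: "(real ^ 'n) measure"
  assumes sets: "sets \<sigma> = sets borel" and "0 < c" "0 < q" "\<alpha> < real CARD('n)"
    and content: "\<forall>E\<in>sets borel.
      emeasure \<sigma> E \<le> ennreal c * ennreal_powr (hausdorff_content (real CARD('n) - \<alpha>) E) q"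
    and \<nu>: "sets \<nu> = sets borel"
  defines "w \<equiv> c powr (1 / q) * (5 * real CARD('n)) powr (real CARD('n) - \<alpha>)"
  shows "weak_Lr_norm q \<sigma> (fractional_maximal \<alpha> \<nu>) \<le> ennreal w * emeasure \<nu> UNIV"
proof -
  have w: "0 < w"
    using \<open>0 < c\<close> by (simp add: w_def)
  note superlevel = emeasure_superlevel_le[OF assms(2-4) content, folded w_def]
  show ?thesis
  proof (cases "emeasure \<nu> UNIV")
    case (real M)
    have sp: "space \<nu> = UNIV"
      using sets_eq_imp_space_eq[OF \<nu>] by simp
    have fm: "finite_measure \<nu>"
      by (rule finite_measureI) (simp add: real(2) sp)
    have M: "measure \<nu> UNIV = M"
      by (simp add: measure_def real)
    have "emeasure \<sigma> {x. ennreal t < fractional_maximal \<alpha> \<nu> x} \<le> ennreal ((w * M / t) powr q)"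
      if "0 < t" for t
    proof -
      have "measure \<nu> {x. ennreal t < fractional_maximal \<alpha> \<nu> x} \<le> M"
        using finite_measure.bounded_measure[OF fm] unfolding sp M .
      then have "(w / t * measure \<nu> {x. ennreal t < fractional_maximal \<alpha> \<nu> x}) powr q
          \<le> (w / t * M) powr q"
        using w that \<open>0 < q\<close> by (intro powr_mono2 mult_left_mono) auto
      then show ?thesis
        using superlevel[OF \<nu> _ that] real(2)
        by (simp add: order.trans[OF _ ennreal_leI])
    qed
    then have "weak_Lr_norm q \<sigma> (fractional_maximal \<alpha> \<nu>) \<le> ennreal (w * M)"
      using \<open>0 < q\<close> w real(1) sets_eq_imp_space_eq[OF sets]
      by (subst weak_Lr_norm_le_iff) auto
    then show ?thesis
      using w real by (simp add: ennreal_mult)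
  next
    case top
    then show ?thesis
      using w by (simp add: ennreal_mult_top)
  qed
qed

text \<open>The superlevel sets may have infinite measure a priori, so the bound is absorbed for the
  restrictions of \<open>\<sigma>\<close> to balls, whose maximal functions increase to that of \<open>\<sigma>\<close>.\<close>

lemma weak_Lr_if_content_bound:
  fixes \<sigma> :: "(real ^ 'n) measure"
  assumes \<sigma>: "\<sigma> \<in> locally_finite_borel_measures" and "0 < c" "0 < q" "q < 1" "\<alpha> < real CARD('n)"
    and content: "\<forall>E\<in>sets borel.
      emeasure \<sigma> E \<le> ennreal c * ennreal_powr (hausdorff_content (real CARD('n) - \<alpha>) E) q"
  shows "fractional_maximal \<alpha> \<sigma> \<in> weak_Lr (q / (1 - q)) \<sigma>"
proof -
  have sets: "sets \<sigma> = sets borel"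
    using \<sigma> by (simp add: locally_finite_borel_measures_def)
  have sp: "space \<sigma> = UNIV"
    using sets_eq_imp_space_eq[OF sets] by simp
  define w where "w = c powr (1 / q) * (5 * real CARD('n)) powr (real CARD('n) - \<alpha>)"
  have w: "0 < w"
    using \<open>0 < c\<close> by (simp add: w_def)
  note superlevel = emeasure_superlevel_le[OF \<open>0 < c\<close> \<open>0 < q\<close> \<open>\<alpha> < real CARD('n)\<close> content,
      folded w_def]
  define B where "B k = cball (0 :: real ^ 'n) (real k)" for k
  define \<rho> where "\<rho> k = density \<sigma> (indicator (B k))" for k
  have B: "B k \<in> sets borel" for k
    by (simp add: B_def)
  have B_mono: "B k \<subseteq> B l" if "k \<le> l" for k l
    using that by (auto simp: B_def)
  have \<rho>: "emeasure (\<rho> k) A = emeasure \<sigma> (B k \<inter> A)" if "A \<in> sets borel" for k A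
    using that B unfolding \<rho>_def by (intro emeasure_restricted) (auto simp: sets)
  have sets_\<rho>: "sets (\<rho> k) = sets borel" for k
    by (simp add: \<rho>_def sets)
  have finite_\<rho>: "emeasure (\<rho> k) UNIV < \<infinity>" for k
    using emeasure_compact_finite[OF \<sigma>, of "B k"] by (simp add: \<rho> B_def)
  have "emeasure \<sigma> {x. ennreal t < fractional_maximal \<alpha> \<sigma> x} \<le> ennreal ((w / t) powr (q / (1 - q)))"
    if t: "0 < t" for t
  proof -
    define E where "E k = {x. ennreal t < fractional_maximal \<alpha> (\<rho> k) x}" for k
    have E: "E k \<in> sets borel" for k
      using open_superlevel_fractional_maximal[of t "\<rho> k" \<alpha>] t sets_\<rho> by (auto simp: E_def)
    have E_mono: "E k \<subseteq> E l" if "k \<le> l" for k l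
    proof -
      have "fractional_maximal \<alpha> (\<rho> k) x \<le> fractional_maximal \<alpha> (\<rho> l) x" for x
        using B_mono[OF that] B
        by (intro fractional_maximal_mono) (auto simp: \<rho> sets intro!: emeasure_mono)
      then show ?thesis
        unfolding E_def by (auto intro: less_le_trans)
    qed
    \<comment> \<open>A witnessing cube is bounded, so it lies in some \<open>B k\<close>, where
      \<open>\<rho> k\<close> and \<sigma> agree; it then witnesses the level for
      \<open>\<rho> k\<close> as well.\<close>
    have "{x. ennreal t < fractional_maximal \<alpha> \<sigma> x} \<subseteq> (\<Union>k. B k \<inter> E k)"
    proof
      fix x assume "x \<in> {x. ennreal t < fractional_maximal \<alpha> \<sigma> x}"
      then obtain a s where s: "0 < s" "x \<in> cube a s"
        and less: "ennreal (t * s powr (real CARD('n) - \<alpha>)) < emeasure \<sigma> (cube a s)"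
        using t by (auto simp: less_fractional_maximal_iff)
      obtain R where R: "\<And>y. y \<in> cube a s \<Longrightarrow> norm y \<le> R"
        using bounded_cbox unfolding bounded_iff by metis
      obtain k :: nat where "R \<le> real k"
        using real_arch_simple by blast
      then have sub: "cube a s \<subseteq> B k"
        using R by (force simp: B_def)
      then have "emeasure (\<rho> k) (cube a s) = emeasure \<sigma> (cube a s)"
        by (simp add: \<rho> Int_absorb1)
      then have "x \<in> E k"
        using s less t less_fractional_maximal_iff[of t \<alpha> "\<rho> k" x]
        by (auto simp: E_def intro!: exI[of _ a] exI[of _ s])
      then show "x \<in> (\<Union>k. B k \<inter> E k)"
        using sub s by auto
    qed
    then have "emeasure \<sigma> {x. ennreal t < fractional_maximal \<alpha> \<sigma> x} \<le> emeasure \<sigma> (\<Union>k. B k \<inter> E k)"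
      using B E by (intro emeasure_mono) (auto simp: sets)
    also have "\<dots> = (SUP k. emeasure \<sigma> (B k \<inter> E k))"
    proof (rule SUP_emeasure_incseq[symmetric])
      show "incseq (\<lambda>k. B k \<inter> E k)"
        by (intro monoI Int_mono B_mono E_mono)
    qed (use B E in \<open>auto simp: sets\<close>)
    also have "\<dots> \<le> ennreal ((w / t) powr (q / (1 - q)))"
    proof (rule SUP_least)
      fix k
      have "emeasure (\<rho> k) (E k) \<le> emeasure (\<rho> k) UNIV"
        by (intro emeasure_mono) (auto simp: sets_\<rho>)
      then have m: "emeasure \<sigma> (B k \<inter> E k) = ennreal (measure (\<rho> k) (E k))"
        using finite_\<rho>[of k] unfolding \<rho>[OF E, symmetric]
        by (intro emeasure_eq_ennreal_measure) (auto simp: top_unique)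
      \<comment> \<open>Passing to the larger set \<open>E k\<close> makes the superlevel estimate
        for \<open>\<rho> k\<close> available. Its right-hand side contains the same finite number
        \<open>measure (\<rho> k) (E k)\<close> as the left, ready for absorption.\<close>
      have "emeasure \<sigma> (B k \<inter> E k) \<le> emeasure \<sigma> (E k)"
        using E by (intro emeasure_mono) (auto simp: sets)
      also have "\<dots> \<le> ennreal ((w / t * measure (\<rho> k) (E k)) powr q)"
        unfolding E_def by (rule superlevel[OF sets_\<rho> finite_\<rho> t])
      finally have "measure (\<rho> k) (E k) \<le> (w / t * measure (\<rho> k) (E k)) powr q"
        unfolding m by (subst (asm) ennreal_le_iff) auto
      then have "measure (\<rho> k) (E k) \<le> (w / t) powr (q / (1 - q))"
        using w t \<open>q < 1\<close> by (intro powr_absorb) auto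
      then show "emeasure \<sigma> (B k \<inter> E k) \<le> ennreal ((w / t) powr (q / (1 - q)))"
        unfolding m by (rule ennreal_leI)
    qed
    finally show ?thesis .
  qed
  then have "weak_Lr_norm (q / (1 - q)) \<sigma> (fractional_maximal \<alpha> \<sigma>) \<le> ennreal w"
    using \<open>0 < q\<close> \<open>q < 1\<close> w by (subst weak_Lr_norm_le_iff) (auto simp: sp)
  then show ?thesis
    using borel_measurable_fractional_maximal[OF sets] measurable_cong_sets[OF sets refl]
    unfolding weak_Lr_def by (auto simp: le_less_trans)
qed

text \<open>The part of \<open>\<Union>i. ball (x i) (r i)\<close> where \<open>M\<^sub>\<alpha> \<sigma> \<le> t\<close> is controlled by \<open>t * S\<close> with
  \<open>S = (\<Sum>i. r i powr d)\<close>, the rest by the weak-type bound; the choice \<open>t = S powr (q - 1)\<close> balances the two contributions.\<close>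

lemma content_bound_if_weak_Lr:
  fixes \<sigma> :: "(real ^ 'n) measure"
  assumes sets: "sets \<sigma> = sets borel" and "0 < q" "q < 1"
    and weak: "fractional_maximal \<alpha> \<sigma> \<in> weak_Lr (q / (1 - q)) \<sigma>"
  defines "d \<equiv> real CARD('n) - \<alpha>"
  shows "\<exists>c>0. \<forall>E. emeasure \<sigma> E \<le> ennreal c * ennreal_powr (hausdorff_content d E) q"
proof -
  have sp: "space \<sigma> = UNIV"
    using sets_eq_imp_space_eq[OF sets] by simp
  obtain w where "weak_Lr_norm (q / (1 - q)) \<sigma> (fractional_maximal \<alpha> \<sigma>) = ennreal w" "0 \<le> w"
    using weak unfolding weak_Lr_def
    by (cases "weak_Lr_norm (q / (1 - q)) \<sigma> (fractional_maximal \<alpha> \<sigma>)") auto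
  then have w: "0 \<le> w" "\<And>t. 0 < t \<Longrightarrow> emeasure \<sigma> {x. ennreal t < fractional_maximal \<alpha> \<sigma> x}
      \<le> ennreal ((w / t) powr (q / (1 - q)))"
    using weak_Lr_norm_le_iff[of "q / (1 - q)" w \<sigma> "fractional_maximal \<alpha> \<sigma>"] assms sp by auto
  \<comment> \<open>The two summands come from the parts outside and inside the superlevel set
    \<open>L\<close>; the first keeps \<open>c\<close> positive even if
    \<open>w = 0\<close>.\<close>
  define c where "c = 2 powr d + w powr (q / (1 - q))"
  have c: "0 < c"
    by (simp add: c_def add_pos_nonneg)
  have "emeasure \<sigma> E \<le> ennreal c * ennreal_powr (hausdorff_content d E) q" for E
  proof (rule le_hausdorff_contentI[OF c \<open>0 < q\<close>])
    fix x :: "nat \<Rightarrow> real ^ 'n" and r :: "nat \<Rightarrow> real" and S :: real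
    assume r: "\<And>i. 0 < r i" and E: "E \<subseteq> (\<Union>i. ball (x i) (r i))"
      and "0 < S" and S: "(\<Sum>i. ennreal (r i powr d)) = ennreal S"
    define t where "t = S powr (q - 1)"
    have t: "0 < t"
      using \<open>0 < S\<close> by (simp add: t_def)
    define L where "L = {x. ennreal t < fractional_maximal \<alpha> \<sigma> x}"
    have L: "L \<in> sets borel"
      using open_superlevel_fractional_maximal[of t \<sigma> \<alpha>] t sets by (auto simp: L_def)
    define Q where "Q i = cube (\<chi> j. x i $ j - r i) (2 * r i)" for i
    have sets_Q: "Q i \<in> sets borel" for i
      by (simp add: Q_def)
    \<comment> \<open>A cube not contained in \<open>L\<close> has a point where the maximal
      function is at most \<open>t\<close>, and this one point bounds the mass of the entire
      cube.\<close>
    have Q: "emeasure \<sigma> (Q i - L) \<le> ennreal (t * 2 powr d) * ennreal (r i powr d)" for i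
    proof (cases "Q i \<subseteq> L")
      case True
      then show ?thesis
        by (simp add: Diff_eq_empty_iff[THEN iffD2])
    next
      case False
      then obtain y where "y \<in> Q i" "y \<notin> L"
        by blast
      then have "emeasure \<sigma> (Q i) \<le> ennreal (t * (2 * r i) powr d)"
        using r[of i] t unfolding Q_def d_def
        by (intro fractional_maximal_le[of y]) (auto simp: L_def not_less)
      also have "\<dots> = ennreal (t * 2 powr d) * ennreal (r i powr d)"
        using r[of i] t by (simp add: powr_mult ennreal_mult mult.assoc)
      finally show ?thesis
        using emeasure_mono[of "Q i - L" "Q i" \<sigma>] sets_Q[of i]
        by (auto simp: sets intro: order.trans)
    qed
    have "emeasure \<sigma> (\<Union>i. Q i - L) \<le> (\<Sum>i. emeasure \<sigma> (Q i - L))"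
      using L sets_Q by (intro emeasure_subadditive_countably) (auto simp: sets)
    also have "\<dots> \<le> (\<Sum>i. ennreal (t * 2 powr d) * ennreal (r i powr d))"
      using Q by (intro suminf_le) auto
    also have "\<dots> = ennreal (t * 2 powr d) * ennreal S"
      unfolding ennreal_suminf_cmult S ..
    also have "\<dots> = ennreal (t * 2 powr d * S)"
      using t \<open>0 < S\<close> by (intro ennreal_mult[symmetric]) auto
    also have "t * 2 powr d * S = 2 powr d * S powr q"
      using \<open>0 < S\<close> by (simp add: t_def powr_diff)
    finally have small: "emeasure \<sigma> (\<Union>i. Q i - L) \<le> ennreal (2 powr d * S powr q)" .
    \<comment> \<open>Raising to the power \<open>q / (1 - q)\<close> turns
      \<open>S powr (1 - q)\<close> into \<open>S powr q\<close>, matching the other part.\<close>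
    have "w / t = w * S powr (1 - q)"
      using \<open>0 < S\<close> by (simp add: t_def powr_diff)
    then have "(w / t) powr (q / (1 - q)) = w powr (q / (1 - q)) * S powr q"
      using w(1) \<open>q < 1\<close> by (simp add: powr_mult powr_powr)
    then have large: "emeasure \<sigma> L \<le> ennreal (w powr (q / (1 - q)) * S powr q)"
      using w(2)[OF t] by (simp add: L_def)
    have "E \<subseteq> (\<Union>i. Q i - L) \<union> L"
      using order.trans[OF E UN_mono[OF subset_refl ball_subset_cube]] by (auto simp: Q_def)
    then have "emeasure \<sigma> E \<le> emeasure \<sigma> ((\<Union>i. Q i - L) \<union> L)"
      using L sets_Q by (intro emeasure_mono) (auto simp: sets)
    also have "\<dots> \<le> emeasure \<sigma> (\<Union>i. Q i - L) + emeasure \<sigma> L"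
      using L sets_Q by (intro emeasure_subadditive) (auto simp: sets)
    also have "\<dots> \<le> ennreal (2 powr d * S powr q) + ennreal (w powr (q / (1 - q)) * S powr q)"
      using small large by (rule add_mono)
    also have "\<dots> = ennreal (c * S powr q)"
      by (simp add: c_def distrib_right flip: ennreal_plus)
    finally show "emeasure \<sigma> E \<le> ennreal (c * S powr q)" .
  qed
  then show ?thesis
    using c by blast
qed

section \<open>Assembly of the equivalences\<close>

theorem theorem3p2:
  fixes \<sigma> :: "(real ^ 'n) measure" and q \<alpha> :: real
  assumes "\<sigma> \<in> locally_finite_borel_measures"
    and "0 < q" and "q < 1"
    and "0 \<le> \<alpha>" and "\<alpha> < real CARD('n)"
  shows "((\<exists>\<kappa>::real. \<kappa> > 0 \<and> (\<forall>\<nu> \<in> locally_finite_borel_measures.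
             weak_Lr_norm q \<sigma> (fractional_maximal \<alpha> \<nu>) \<le> ennreal \<kappa> * emeasure \<nu> UNIV))
          \<longleftrightarrow>
          (\<exists>C::real. C > 0 \<and> (\<forall>E \<in> sets borel.
             emeasure \<sigma> E \<le> ennreal C * ennreal_powr (hausdorff_content (real CARD('n) - \<alpha>) E) q)))
         \<and>
         ((\<exists>C::real. C > 0 \<and> (\<forall>E \<in> sets borel.
             emeasure \<sigma> E \<le> ennreal C * ennreal_powr (hausdorff_content (real CARD('n) - \<alpha>) E) q))
          \<longleftrightarrow>
          fractional_maximal \<alpha> \<sigma> \<in> weak_Lr (q / (1 - q)) \<sigma>)"
proof (intro conjI iffI)
  note \<sigma> = assms(1)
  have sets: "sets \<sigma> = sets borel"
    using \<sigma> by (simp add: locally_finite_borel_measures_def)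
  let ?max = "\<exists>\<kappa>::real. \<kappa> > 0 \<and> (\<forall>\<nu> \<in> locally_finite_borel_measures.
             weak_Lr_norm q \<sigma> (fractional_maximal \<alpha> \<nu>) \<le> ennreal \<kappa> * emeasure \<nu> UNIV)"
  let ?content = "\<exists>C::real. C > 0 \<and> (\<forall>E \<in> sets borel.
             emeasure \<sigma> E \<le> ennreal C * ennreal_powr (hausdorff_content (real CARD('n) - \<alpha>) E) q)"
  show ?content if ?max
  proof -
    from that obtain k where k: "0 < k" "\<And>\<nu>. \<nu> \<in> locally_finite_borel_measures \<Longrightarrow>
        weak_Lr_norm q \<sigma> (fractional_maximal \<alpha> \<nu>) \<le> ennreal k * emeasure \<nu> UNIV"
      by blast
    show ?thesis
      using content_bound_if_maximal_bound[OF sets \<open>0 < q\<close> k] k(1)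
      by (intro exI[of _ "(k * 2 powr (real CARD('n) - \<alpha> + 1)) powr q"]) auto
  qed
  show ?max if ?content
  proof -
    from that obtain c where c: "0 < c" "\<forall>E\<in>sets borel.
        emeasure \<sigma> E \<le> ennreal c * ennreal_powr (hausdorff_content (real CARD('n) - \<alpha>) E) q"
      by blast
    show ?thesis
      using maximal_bound_if_content_bound[OF sets c(1) \<open>0 < q\<close> assms(5) c(2)] c(1)
      unfolding locally_finite_borel_measures_def
      by (intro exI[of _ "c powr (1 / q) * (5 * real CARD('n)) powr (real CARD('n) - \<alpha>)"]) auto
  qed
  show "fractional_maximal \<alpha> \<sigma> \<in> weak_Lr (q / (1 - q)) \<sigma>" if ?content
    using that weak_Lr_if_content_bound[OF \<sigma> _ assms(2,3,5)] by blast
  show ?content if "fractional_maximal \<alpha> \<sigma> \<in> weak_Lr (q / (1 - q)) \<sigma>"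
    using content_bound_if_weak_Lr[OF sets assms(2,3) that] by blast
qed

end
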